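(* Let $f:I\subseteq\mathbb{R}\to\mathbb{R}$ be a differentiable mapping on $I^{\circ}$ such that $f'\in L[a,b]$, where $a,b\in I^{\circ}$ with $a<b$, and let $\alpha,\lambda\in[0,1]$. If $|f'|^{q}$ is a $P$-function on $[a,b]$, $q\geq 1$, then $$|I_{f}(\lambda,\alpha,a,b)|\leq (b-a)\left(|f'(b)|^{q}+|f'(a)|^{q}\right)^{\frac1q}\times\begin{cases}\gamma_{2}(\alpha,\lambda)+\gamma_{2}(1-\alpha,\lambda), & \alpha\lambda\leq 1-\alpha\leq 1-\lambda(1-\alpha),\\ \gamma_{2}(\alpha,\lambda)+\gamma_{1}(1-\alpha,\lambda), & \alpha\lambda\leq 1-\lambda(1-\alpha)\leq 1-\alpha,\\ \gamma_{1}(\alpha,\lambda)+\gamma_{2}(1-\alpha,\lambda), & 1-\alpha\leq\alpha\lambda\leq 1-\lambda(1-\alpha),\end{cases}$$ where $$\gamma_{1}(\alpha,\lambda)=(1-\alpha)\left[\alpha\lambda-\frac{1-\alpha}{2}\right],\qquad \gamma_{2}(\alpha,\lambda)=(\alpha\lambda)^{2}-\gamma_{1}(\alpha,\lambda).$$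
   Context: $I$ is an interval of real numbers and $I^{\circ}$ is its interior. $L[a,b]$ denotes the integrable functions on $[a,b]$. A function $g:J\to\mathbb{R}$ on an interval $J$ is a $P$-function if $g$ is non-negative and $g(tx+(1-t)y)\leq g(x)+g(y)$ for all $x,y\in J$ and $t\in[0,1]$. For $a<b$ in $I^{\circ}$ and $\alpha,\lambda\in[0,1]$, $$I_{f}(\lambda,\alpha,a,b)=\lambda\left(\alpha f(a)+(1-\alpha)f(b)\right)+(1-\lambda)f(\alpha a+(1-\alpha)b)-\frac{1}{b-a}\int_{a}^{b}f(x)\,dx.$$ *)

theory Defs
  imports "HOL-Analysis.Analysis"
begin

definition P_function_on :: "real set \<Rightarrow> (real \<Rightarrow> real) \<Rightarrow> bool" where
  "P_function_on J g \<longleftrightarrow>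
     is_interval J \<and> (\<forall>x\<in>J. 0 \<le> g x) \<and>
     (\<forall>x\<in>J. \<forall>y\<in>J. \<forall>t\<in>{0..1}. g (t * x + (1 - t) * y) \<le> g x + g y)"

definition I_fun :: "(real \<Rightarrow> real) \<Rightarrow> real \<Rightarrow> real \<Rightarrow> real \<Rightarrow> real \<Rightarrow> real" where
  "I_fun f l \<alpha> a b =
     l * (\<alpha> * f a + (1 - \<alpha>) * f b) + (1 - l) * f (\<alpha> * a + (1 - \<alpha>) * b)
     - 1 / (b - a) * integral {a..b} f"

definition gamma1 :: "real \<Rightarrow> real \<Rightarrow> real" where
  "gamma1 \<alpha> l = (1 - \<alpha>) * (\<alpha> * l - (1 - \<alpha>) / 2)"

definition gamma2 :: "real \<Rightarrow> real \<Rightarrow> real" where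
  "gamma2 \<alpha> l = (\<alpha> * l)\<^sup>2 - gamma1 \<alpha> l"

end

theory Submission
  imports Defs
begin

text \<open>
  Write \<open>h = b - a\<close> and \<open>c = \<alpha> a + (1 - \<alpha>) b\<close>.  Integration by parts on the two halves
  \<open>[a, c]\<close> and \<open>[c, b]\<close>, with integration constants \<open>u = a + h \<alpha> l\<close> and
  \<open>v = b - h l (1 - \<alpha>)\<close> chosen so that the boundary terms reproduce the weights of
  \<open>I_fun\<close>, gives
  \<open>h I_f = \<integral>\<^sub>a\<^sup>c (x - u) f'(x) dx + \<integral>\<^sub>c\<^sup>b (x - v) f'(x) dx\<close>.

  A \<open>P\<close>-function on \<open>[a, b]\<close> is bounded by the sum of its values at the end points,
  since every point of the interval is a convex combination of them.  Hence
  \<open>\<bar>f'\<bar> \<le> M = (\<bar>f'(b)\<bar>\<^sup>q + \<bar>f'(a)\<bar>\<^sup>q)\<^bsup>1/q\<^esup>\<close>, uniformly in \<open>x\<close>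
  (\<open>P_function_abs_powr_bound\<close>), and it remains to integrate \<open>\<bar>x - u\<bar>\<close> and \<open>\<bar>x - v\<bar>\<close>
  (\<open>parts_bound\<close>).  Reflecting the second half turns it into the first one with
  \<open>1 - \<alpha>\<close> for \<open>\<alpha>\<close>, so both are values of a single function (\<open>kernel_mass\<close>) times
  \<open>h\<^sup>2\<close>.  The case distinction of the theorem only records whether \<open>u\<close> and \<open>v\<close>
  lie in their own half: if so, the kernel changes sign there and its mass is a
  \<open>gamma2\<close>; if not, it has constant sign and its mass is a \<open>gamma1\<close>.
\<close>

text \<open>
  The function \<open>z \<bar>z\<bar> / 2\<close> is a primitive of \<open>\<bar>z\<bar>\<close> across the sign change, which
  yields one formula for every position of \<open>u\<close> relative to the interval.
\<close>

lemma has_integral_abs_diff: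
  fixes p r u :: real
  assumes "p \<le> r"
  shows "((\<lambda>x. \<bar>x - u\<bar>) has_integral
           (r - u) * \<bar>r - u\<bar> / 2 - (p - u) * \<bar>p - u\<bar> / 2) {p..r}"
proof (rule fundamental_theorem_of_calculus_interior_strong[where S = "{u}"])
  show "((\<lambda>x. (x - u) * \<bar>x - u\<bar> / 2) has_vector_derivative \<bar>x - u\<bar>) (at x)"
    if "x \<in> {p<..<r} - {u}" for x
  proof (cases "x > u")
    case True
    have "((\<lambda>x. (x - u) * (x - u) / 2) has_real_derivative \<bar>x - u\<bar>) (at x)"
      using True by (auto intro!: derivative_eq_intros)
    then have "((\<lambda>x. (x - u) * \<bar>x - u\<bar> / 2) has_real_derivative \<bar>x - u\<bar>) (at x)"
      by (rule has_field_derivative_transform_within_open[where S = "{u<..}"])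
         (use True in auto)
    then show ?thesis
      by (simp add: has_real_derivative_iff_has_vector_derivative)
  next
    case False
    then have "x < u" using that by auto
    have "((\<lambda>x. (x - u) * (u - x) / 2) has_real_derivative \<bar>x - u\<bar>) (at x)"
      using \<open>x < u\<close> by (auto intro!: derivative_eq_intros simp: field_simps)
    then have "((\<lambda>x. (x - u) * \<bar>x - u\<bar> / 2) has_real_derivative \<bar>x - u\<bar>) (at x)"
      by (rule has_field_derivative_transform_within_open[where S = "{..<u}"])
         (use \<open>x < u\<close> in auto)
    then show ?thesis
      by (simp add: has_real_derivative_iff_has_vector_derivative)
  qed
qed (use assms in \<open>auto intro!: continuous_intros\<close>)

text \<open>
  Inside the absolute value on the left is \<open>\<integral> (x - u) f'(x) dx\<close>, integrated by parts:
  \<open>(x - u) f'(x)\<close> is everywhere the derivative of \<open>(x - u) f(x) - \<integral>\<^sub>p\<^sup>x f\<close>, so the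
  fundamental theorem of calculus for the Henstock-Kurzweil integral gives both its
  integrability and its integral.
\<close>

lemma parts_bound:
  fixes f f' :: "real \<Rightarrow> real" and p r u M :: real
  assumes "p \<le> r"
    and deriv: "\<And>x. x \<in> {p..r} \<Longrightarrow> (f has_real_derivative f' x) (at x within {p..r})"
    and bound: "\<And>x. x \<in> {p..r} \<Longrightarrow> \<bar>f' x\<bar> \<le> M"
  shows "\<bar>(r - u) * f r - (p - u) * f p - integral {p..r} f\<bar>
           \<le> M * ((r - u) * \<bar>r - u\<bar> / 2 - (p - u) * \<bar>p - u\<bar> / 2)"
proof -
  let ?G = "\<lambda>x. (x - u) * f x - integral {p..x} f"
  have cont: "continuous_on {p..r} f"
    using deriv by (rule DERIV_continuous_on)
  have "((\<lambda>x. (x - u) * f' x) has_integral (?G r - ?G p)) {p..r}"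
  proof (rule fundamental_theorem_of_calculus[OF \<open>p \<le> r\<close>])
    fix x assume x: "x \<in> {p..r}"
    have "(?G has_real_derivative (x - u) * f' x) (at x within {p..r})"
      by (rule derivative_eq_intros deriv[OF x] integral_has_real_derivative[OF cont x] refl)+ simp
    then show "(?G has_vector_derivative (x - u) * f' x) (at x within {p..r})"
      by (simp add: has_real_derivative_iff_has_vector_derivative)
  qed
  then have parts: "((\<lambda>x. (x - u) * f' x) has_integral
      (r - u) * f r - (p - u) * f p - integral {p..r} f) {p..r}"
    by (simp add: algebra_simps)
  have mass: "((\<lambda>x. M * \<bar>x - u\<bar>) has_integral
      M * ((r - u) * \<bar>r - u\<bar> / 2 - (p - u) * \<bar>p - u\<bar> / 2)) {p..r}"
    by (rule has_integral_mult_right[OF has_integral_abs_diff[OF \<open>p \<le> r\<close>]])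
  have "norm ((x - u) * f' x) \<le> M * \<bar>x - u\<bar>" if "x \<in> {p..r}" for x
    using mult_right_mono[OF bound[OF that], of "\<bar>x - u\<bar>"]
    by (simp add: abs_mult mult.commute)
  then have "norm (integral {p..r} (\<lambda>x. (x - u) * f' x)) \<le> integral {p..r} (\<lambda>x. M * \<bar>x - u\<bar>)"
    by (intro integral_norm_bound_integral has_integral_integrable[OF parts]
        has_integral_integrable[OF mass])
  then show ?thesis
    unfolding integral_unique[OF parts] integral_unique[OF mass] by simp
qed

lemma P_function_on_endpoint_bound:
  assumes "P_function_on {a..b} g" and "x \<in> {a..b}" and "a < b"
  shows "g x \<le> g a + g b"
proof -
  define t where "t = (b - x) / (b - a)"
  have "t \<in> {0..1}"
    using assms(2,3) by (simp add: t_def)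
  moreover have "t * (b - a) = b - x"
    using \<open>a < b\<close> by (simp add: t_def)
  then have "x = t * a + (1 - t) * b"
    by (simp add: algebra_simps)
  moreover have "a \<in> {a..b}" and "b \<in> {a..b}"
    using \<open>a < b\<close> by auto
  ultimately show ?thesis
    using assms(1) unfolding P_function_on_def by metis
qed

lemma P_function_abs_powr_bound:
  fixes g :: "real \<Rightarrow> real" and q :: real
  assumes "P_function_on {a..b} (\<lambda>x. \<bar>g x\<bar> powr q)" and "x \<in> {a..b}" and "a < b" and "q > 0"
  shows "\<bar>g x\<bar> \<le> (\<bar>g b\<bar> powr q + \<bar>g a\<bar> powr q) powr (1 / q)"
proof -
  have "\<bar>g x\<bar> = (\<bar>g x\<bar> powr q) powr (1 / q)"
    using \<open>q > 0\<close> by (simp add: powr_powr)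
  also have "\<dots> \<le> (\<bar>g b\<bar> powr q + \<bar>g a\<bar> powr q) powr (1 / q)"
    using P_function_on_endpoint_bound[OF assms(1-3)] \<open>q > 0\<close>
    by (intro powr_mono2) auto
  finally show ?thesis .
qed

text \<open>
  For \<open>\<alpha>, l \<in> [0, 1]\<close> this is \<open>\<integral> \<bar>t - \<alpha> l\<bar> dt\<close> over \<open>[0, 1 - \<alpha>]\<close>, evaluated with the primitive
  \<open>z \<bar>z\<bar> / 2\<close>; the lower end point contributes the square because \<open>\<alpha> l \<ge> 0\<close>.
\<close>

definition kernel_mass :: "real \<Rightarrow> real \<Rightarrow> real" where
  "kernel_mass \<alpha> l = ((1 - \<alpha> - \<alpha> * l) * \<bar>1 - \<alpha> - \<alpha> * l\<bar> + (\<alpha> * l)\<^sup>2) / 2"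

lemma kernel_mass_eq_gamma2: "\<alpha> * l \<le> 1 - \<alpha> \<Longrightarrow> kernel_mass \<alpha> l = gamma2 \<alpha> l"
  by (simp add: kernel_mass_def gamma2_def gamma1_def power2_eq_square field_simps)

lemma kernel_mass_eq_gamma1: "1 - \<alpha> \<le> \<alpha> * l \<Longrightarrow> kernel_mass \<alpha> l = gamma1 \<alpha> l"
  by (simp add: kernel_mass_def gamma1_def power2_eq_square field_simps)

text \<open>
  The boundary terms of \<open>parts_bound\<close> have total weight \<open>u - a\<close> at \<open>a\<close>, \<open>b - v\<close> at \<open>b\<close> and
  \<open>v - u\<close> at \<open>c\<close>.  Equating them with \<open>b - a\<close> times the weights \<open>l \<alpha>\<close>, \<open>l (1 - \<alpha>)\<close> and
  \<open>1 - l\<close> in \<open>I_fun\<close> determines \<open>u\<close> and \<open>v\<close> below.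
\<close>

lemma I_fun_bound:
  fixes f f' :: "real \<Rightarrow> real" and a b \<alpha> l M :: real
  assumes "a < b" and \<alpha>: "0 \<le> \<alpha>" "\<alpha> \<le> 1" and "0 \<le> l"
    and deriv: "\<And>x. x \<in> {a..b} \<Longrightarrow> (f has_real_derivative f' x) (at x within {a..b})"
    and bound: "\<And>x. x \<in> {a..b} \<Longrightarrow> \<bar>f' x\<bar> \<le> M"
  shows "\<bar>I_fun f l \<alpha> a b\<bar> \<le> (b - a) * M * (kernel_mass \<alpha> l + kernel_mass (1 - \<alpha>) l)"
proof -
  define h where "h = b - a"
  define c where "c = \<alpha> * a + (1 - \<alpha>) * b"
  define u where "u = a + h * (\<alpha> * l)"
  define v where "v = b - h * (l * (1 - \<alpha>))"
  have "h > 0" using \<open>a < b\<close> by (simp add: h_def)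
  have ca: "c - a = h * (1 - \<alpha>)" and bc: "b - c = h * \<alpha>"
    by (simp_all add: c_def h_def algebra_simps)
  have "a \<le> c" "c \<le> b"
    using ca bc mult_nonneg_nonneg[of h "1 - \<alpha>"] mult_nonneg_nonneg[of h \<alpha>] \<open>h > 0\<close> \<alpha>
    by linarith+
  have au: "a - u = - (h * (\<alpha> * l))" and cu: "c - u = h * (1 - \<alpha> - \<alpha> * l)"
    using ca by (simp_all add: u_def algebra_simps)
  have bv: "b - v = h * ((1 - \<alpha>) * l)" and cv: "c - v = - (h * (\<alpha> - (1 - \<alpha>) * l))"
    using bc by (simp_all add: v_def algebra_simps)
  have scale: "(h * z) * \<bar>h * z\<bar> = h\<^sup>2 * (z * \<bar>z\<bar>)"
              "- (h * z) * \<bar>- (h * z)\<bar> = - (h\<^sup>2 * (z * \<bar>z\<bar>))" for z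
    using \<open>h > 0\<close> by (simp_all add: abs_mult power2_eq_square)
  have nonneg: "\<bar>\<alpha> * l\<bar> = \<alpha> * l" "\<bar>(1 - \<alpha>) * l\<bar> = (1 - \<alpha>) * l"
    using \<alpha> \<open>0 \<le> l\<close> by simp_all
  have massl: "(c - u) * \<bar>c - u\<bar> / 2 - (a - u) * \<bar>a - u\<bar> / 2 = h\<^sup>2 * kernel_mass \<alpha> l"
    unfolding au cu scale nonneg kernel_mass_def
    by (simp add: power2_eq_square field_simps)
  have massr: "(b - v) * \<bar>b - v\<bar> / 2 - (c - v) * \<bar>c - v\<bar> / 2 = h\<^sup>2 * kernel_mass (1 - \<alpha>) l"
    unfolding bv cv scale nonneg kernel_mass_def
    by (simp add: power2_eq_square field_simps)
  have "\<bar>(c - u) * f c - (a - u) * f a - integral {a..c} f\<bar> \<le> M * (h\<^sup>2 * kernel_mass \<alpha> l)"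
    unfolding massl[symmetric]
    using \<open>a \<le> c\<close> \<open>c \<le> b\<close>
    by (intro parts_bound[where f' = f'] bound DERIV_subset[OF deriv]) auto
  moreover have "\<bar>(b - v) * f b - (c - v) * f c - integral {c..b} f\<bar>
      \<le> M * (h\<^sup>2 * kernel_mass (1 - \<alpha>) l)"
    unfolding massr[symmetric]
    using \<open>a \<le> c\<close> \<open>c \<le> b\<close>
    by (intro parts_bound[where f' = f'] bound DERIV_subset[OF deriv]) auto
  moreover have "h * I_fun f l \<alpha> a b =
      ((c - u) * f c - (a - u) * f a - integral {a..c} f)
      + ((b - v) * f b - (c - v) * f c - integral {c..b} f)"
  proof -
    have "f integrable_on {a..b}"
      using deriv by (intro integrable_continuous_interval DERIV_continuous_on)
    then have "integral {a..b} f = integral {a..c} f + integral {c..b} f"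
      using \<open>a \<le> c\<close> \<open>c \<le> b\<close> by (simp add: Henstock_Kurzweil_Integration.integral_combine)
    moreover have "h * I_fun f l \<alpha> a b =
        h * (l * (\<alpha> * f a + (1 - \<alpha>) * f b) + (1 - l) * f c) - integral {a..b} f"
      using \<open>h > 0\<close> unfolding I_fun_def c_def[symmetric] h_def[symmetric]
      by (simp add: field_simps)
    ultimately show ?thesis
      unfolding au bv cu cv by (simp add: algebra_simps)
  qed
  ultimately have "\<bar>h * I_fun f l \<alpha> a b\<bar>
      \<le> M * (h\<^sup>2 * kernel_mass \<alpha> l) + M * (h\<^sup>2 * kernel_mass (1 - \<alpha>) l)"
    by linarith
  also have "\<dots> = h * (h * M * (kernel_mass \<alpha> l + kernel_mass (1 - \<alpha>) l))"
    by (simp add: power2_eq_square algebra_simps)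
  finally show ?thesis
    using \<open>h > 0\<close> by (simp add: abs_mult h_def)
qed

theorem theorem2:
  fixes I :: "real set" and f :: "real \<Rightarrow> real" and a b \<alpha> l q :: real
  assumes "is_interval I"
    and "\<forall>x\<in>interior I. f differentiable (at x)"
    and "a \<in> interior I" and "b \<in> interior I" and "a < b"
    and "deriv f absolutely_integrable_on {a..b}"
    and "\<alpha> \<in> {0..1}" and "l \<in> {0..1}"
    and "q \<ge> 1"
    and "P_function_on {a..b} (\<lambda>x. \<bar>deriv f x\<bar> powr q)"
  shows
    "(\<alpha> * l \<le> 1 - \<alpha> \<and> 1 - \<alpha> \<le> 1 - l * (1 - \<alpha>) \<longrightarrow>
       \<bar>I_fun f l \<alpha> a b\<bar> \<le>
         (b - a) * (\<bar>deriv f b\<bar> powr q + \<bar>deriv f a\<bar> powr q) powr (1 / q)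
         * (gamma2 \<alpha> l + gamma2 (1 - \<alpha>) l)) \<and>
     (\<alpha> * l \<le> 1 - l * (1 - \<alpha>) \<and> 1 - l * (1 - \<alpha>) \<le> 1 - \<alpha> \<longrightarrow>
       \<bar>I_fun f l \<alpha> a b\<bar> \<le>
         (b - a) * (\<bar>deriv f b\<bar> powr q + \<bar>deriv f a\<bar> powr q) powr (1 / q)
         * (gamma2 \<alpha> l + gamma1 (1 - \<alpha>) l)) \<and>
     (1 - \<alpha> \<le> \<alpha> * l \<and> \<alpha> * l \<le> 1 - l * (1 - \<alpha>) \<longrightarrow>
       \<bar>I_fun f l \<alpha> a b\<bar> \<le>
         (b - a) * (\<bar>deriv f b\<bar> powr q + \<bar>deriv f a\<bar> powr q) powr (1 / q)
         * (gamma1 \<alpha> l + gamma2 (1 - \<alpha>) l))"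
proof -
  define M where "M = (\<bar>deriv f b\<bar> powr q + \<bar>deriv f a\<bar> powr q) powr (1 / q)"
  have "is_interval (interior I)"
    using assms(1) by (simp add: is_interval_convex_1)
  then have sub: "{a..b} \<subseteq> interior I"
    using assms(3,4) by (meson atLeastAtMost_iff mem_is_interval_1_I subsetI)
  have "(f has_real_derivative deriv f x) (at x within {a..b})" if "x \<in> {a..b}" for x
  proof (rule has_field_derivative_at_within)
    show "(f has_real_derivative deriv f x) (at x)"
      using assms(2) sub that unfolding DERIV_deriv_iff_real_differentiable by blast
  qed
  moreover have "\<bar>deriv f x\<bar> \<le> M" if "x \<in> {a..b}" for x
    unfolding M_def using assms(5,9,10) that by (intro P_function_abs_powr_bound) auto
  ultimately have "\<bar>I_fun f l \<alpha> a b\<bar>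
      \<le> (b - a) * M * (kernel_mass \<alpha> l + kernel_mass (1 - \<alpha>) l)"
    using assms(5,7,8) by (intro I_fun_bound) auto
  then show ?thesis
    using kernel_mass_eq_gamma1[of \<alpha> l] kernel_mass_eq_gamma2[of \<alpha> l]
      kernel_mass_eq_gamma1[of "1 - \<alpha>" l] kernel_mass_eq_gamma2[of "1 - \<alpha>" l]
    unfolding M_def[symmetric] by (auto simp: mult.commute)
qed

end
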